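(* The functions sending $(1^n\,0\,1^a\,0\,1^b)$, where $1\le a\le b\le n$, to the differences $$\binom{n}{a}\binom{n}{b}-\binom{n}{a-1}\binom{n}{b+1}\quad\text{and}\quad\binom{n+a}{n}\binom{n+b}{n}-\binom{n+a-1}{n}\binom{n+b+1}{n}$$ are both in $\#\mathsf{L}$.
   Context: The alphabet is $\Sigma=\{0,1\}$; $1^a$ is the string of $a$ ones and juxtaposition is concatenation. A function given only on strings of a specified form is extended by $0$ to all other strings. $\#\mathsf{L}$ is the class of functions $f:\Sigma^*\to\mathbb{N}_0$ such that $f(x)$ is the number of accepting computation paths on input $x$ of a fixed nondeterministic Turing machine with read-only input tape that uses $O(\log|x|)$ work space and halts on every computation path. Equivalently: there are a polynomial $q$ and a deterministic $O(\log|x|)$-space Turing machine $M$ with an additional read-once, left-to-right witness tape such that $f(x)=\#\{w\in\Sigma^{q(|x|)}\mid M(x,w)=\mathsf{yes}\}$. *)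

theory Defs
  imports Complex_Main "HOL-Library.Landau_Symbols"
begin

datatype dir = MoveLeft | Stay | MoveRight

primrec shift :: "dir \<Rightarrow> int" where
  "shift MoveLeft = -1"
| "shift Stay = 0"
| "shift MoveRight = 1"

datatype input_symbol = LeftEnd | Bit bool | RightEnd

text \<open>
  Strings over \<open>{0,1}\<close> are Boolean lists, \<open>True\<close> being the letter \<open>1\<close>. The read-only input tape
  holds the input between two end markers.
\<close>

definition input_tape :: "bool list \<Rightarrow> input_symbol list" where
  "input_tape x = LeftEnd # map Bit x @ [RightEnd]"

text \<open>
  Nondeterministic Turing machines with one work tape, infinite in both directions. A transition
  \<open>(q, a, g, q', g', d, e)\<close> is applicable in state \<open>q\<close> when the input head reads \<open>a\<close> and the work
  head reads \<open>g\<close>; it changes the state to \<open>q'\<close>, overwrites the work symbol by \<open>g'\<close>, and moves the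
  input head by \<open>d\<close> and the work head by \<open>e\<close>. The state set and the work alphabet are left implicit:
  as there are finitely many transitions, only finitely many states and symbols matter.
\<close>

record ('q, 'g) ntm =
  start :: 'q
  accepting :: "'q set"
  blank :: 'g
  transitions :: "('q \<times> input_symbol \<times> 'g \<times> 'q \<times> 'g \<times> dir \<times> dir) set"

text \<open>The two implications keep the input head on the input tape.\<close>

definition wf_ntm :: "('q, 'g) ntm \<Rightarrow> bool" where
  "wf_ntm M \<longleftrightarrow> finite (transitions M) \<and>
     (\<forall>(q, a, g, q', g', d, e) \<in> transitions M.
        (a = LeftEnd \<longrightarrow> d \<noteq> MoveLeft) \<and> (a = RightEnd \<longrightarrow> d \<noteq> MoveRight))"

record ('q, 'g) config =
  state :: 'q
  input_pos :: int
  work_pos :: int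
  work_tape :: "int \<Rightarrow> 'g"

definition initial :: "('q, 'g) ntm \<Rightarrow> ('q, 'g) config" where
  "initial M = \<lparr>state = start M, input_pos = 0, work_pos = 0, work_tape = (\<lambda>_. blank M)\<rparr>"

definition step :: "('q, 'g) ntm \<Rightarrow> bool list \<Rightarrow> ('q, 'g) config \<Rightarrow> ('q, 'g) config \<Rightarrow> bool" where
  "step M x c c' \<longleftrightarrow> (\<exists>q' g' d e.
     (state c, input_tape x ! nat (input_pos c), work_tape c (work_pos c), q', g', d, e)
       \<in> transitions M \<and>
     c' = \<lparr>state = q', input_pos = input_pos c + shift d, work_pos = work_pos c + shift e,
           work_tape = (work_tape c)(work_pos c := g')\<rparr>)"

text \<open>
  Computations are recorded as sequences of configurations. Different transitions applicable to a
  configuration lead to different successors, so this is the same as recording the sequence of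
  nondeterministic choices.
\<close>

definition computation :: "('q, 'g) ntm \<Rightarrow> bool list \<Rightarrow> ('q, 'g) config list \<Rightarrow> bool" where
  "computation M x p \<longleftrightarrow> p \<noteq> [] \<and> hd p = initial M \<and> successively (step M x) p"

definition accepting_path :: "('q, 'g) ntm \<Rightarrow> bool list \<Rightarrow> ('q, 'g) config list \<Rightarrow> bool" where
  "accepting_path M x p \<longleftrightarrow> computation M x p \<and>
     (\<nexists>c. step M x (last p) c) \<and> state (last p) \<in> accepting M"

definition always_halts :: "('q, 'g) ntm \<Rightarrow> bool" where
  "always_halts M \<longleftrightarrow>
     (\<forall>x. \<nexists>r :: nat \<Rightarrow> ('q, 'g) config. r 0 = initial M \<and> (\<forall>i. step M x (r i) (r (Suc i))))"

text \<open>The work space used by a computation is the number of work cells its head visits.\<close>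

definition log_space :: "('q, 'g) ntm \<Rightarrow> bool" where
  "log_space M \<longleftrightarrow> (\<exists>s :: nat \<Rightarrow> real. s \<in> O(\<lambda>n. ln (real n)) \<and>
     (\<forall>x p. computation M x p \<longrightarrow> real (card (work_pos ` set p)) \<le> s (length x)))"

text \<open>
  Natural numbers serve as names for states and work symbols. The set of accepting paths is finite,
  because the machine branches finitely and has no infinite computation.
\<close>

definition sharpL :: "(bool list \<Rightarrow> nat) set" where
  "sharpL = {\<lambda>x. card {p. accepting_path M x p} | M :: (nat, nat) ntm.
     wf_ntm M \<and> always_halts M \<and> log_space M}"

definition encode :: "nat \<Rightarrow> nat \<Rightarrow> nat \<Rightarrow> bool list" where
  "encode n a b = replicate n True @ [False] @ replicate a True @ [False] @ replicate b True"

text \<open>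
  \<open>f\<close> is the function \<open>encode n a b \<mapsto> g n a b\<close> (for \<open>1 \<le> a \<le> b \<le> n\<close>), extended by \<open>0\<close>. The values
  of \<open>g\<close> are integers in order that differences are not truncated.
\<close>

definition is_zero_extension :: "(nat \<Rightarrow> nat \<Rightarrow> nat \<Rightarrow> int) \<Rightarrow> (bool list \<Rightarrow> nat) \<Rightarrow> bool" where
  "is_zero_extension g f \<longleftrightarrow>
     (\<forall>n a b. 1 \<le> a \<and> a \<le> b \<and> b \<le> n \<longrightarrow> int (f (encode n a b)) = g n a b) \<and>
     (\<forall>x. (\<nexists>n a b. 1 \<le> a \<and> a \<le> b \<and> b \<le> n \<and> x = encode n a b) \<longrightarrow> f x = 0)"

end

theory Submission
  imports Defs "HOL-Library.Countable"
begin

text \<open>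
  Both differences satisfy recursions with nonnegative terms, and a nondeterministic machine can
  follow such a recursion: it keeps the arguments in binary counters, guesses one of the terms at
  every unfolding, and accepts at the base cases of value \<open>1\<close>. The number of its accepting paths is
  the value of the recursion, and counters bounded by the input length need logarithmic space.

  Put \<open>y = b - a\<close>. The first difference counts the pairs of binary words of length \<open>n\<close> with \<open>a\<close>
  and \<open>b\<close> ones in which every suffix of the second word has at least as many ones as
  the suffix of the first word of the same length. By Pascal's rule, the difference for \<open>n + 1\<close> is
  the sum of the differences for \<open>n\<close> at \<open>(a - d, b - e)\<close> with \<open>d, e \<in> {0, 1}\<close>, and the one illegal
  term, with \<open>a - d = b - e + 1\<close>, vanishes as the two products agree (\<open>dominating_pairs_eq\<close>).
  The second difference is the Jacobi-Trudi determinant that counts the semistandard Young tableaux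
  of shape \<open>(b, a)\<close> over \<open>n + 1\<close> letters. Here the recursion deletes the occurrences of the largest
  letter one at a time, first from the upper row and then from the lower row (\<open>tableaux_eq\<close>). In both
  recursions the condition \<open>a \<le> b\<close> is a test for zero on the counter for \<open>y\<close>.

  The machine is obtained from a program for counters that are incremented and decremented with a
  test for zero. The digits of the counters are stored on parallel tracks of the work tape, and each
  instruction is carried out deterministically, so that only the branching instruction has an
  influence on the number of accepting paths. The rules \<open>counts_Inc\<close>, \<open>counts_Dec\<close>, \<open>counts_Fork\<close> and so
  on compute this number backwards along the program; they refer to a machine only through the
  predicate \<open>runs\<close>, which records termination, space and the number of accepting paths at once.
  The program reads the input, rejects unless it has the form \<open>encode n a b\<close> with
  \<open>1 \<le> a \<le> b \<le> n\<close>, and then enters the loop for one of the recursions.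
\<close>

section \<open>Runs with a known number of accepting paths\<close>

text \<open>
  \<open>runs M x W c k\<close>: from the configuration \<open>c\<close>, every computation on input \<open>x\<close> halts and keeps its
  work head within \<open>W\<close>, and exactly \<open>k\<close> of the maximal computations accept.
\<close>

inductive runs ::
  "('q, 'g) ntm \<Rightarrow> bool list \<Rightarrow> int set \<Rightarrow> ('q, 'g) config \<Rightarrow> nat \<Rightarrow> bool"
  for M x W
where
  runs_halt: "\<lbrakk>work_pos c \<in> W; \<nexists>c'. step M x c c'\<rbrakk>
    \<Longrightarrow> runs M x W c (if state c \<in> accepting M then 1 else 0)"
| runs_step: "\<lbrakk>work_pos c \<in> W; {c'. step M x c c'} = S; S \<noteq> {}; finite S;
      \<And>c'. c' \<in> S \<Longrightarrow> runs M x W c' (f c')\<rbrakk>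
    \<Longrightarrow> runs M x W c (sum f S)"

lemma runs_unique_successor:
  assumes "work_pos c \<in> W" "{c'. step M x c c'} = {d}" "runs M x W d k"
  shows "runs M x W c k"
  using runs_step[of c W M x "{d}" "\<lambda>_. k"] assms by simp

lemma runs_two_successors:
  assumes "work_pos c \<in> W" "{c'. step M x c c'} = {d, e}" "d \<noteq> e" "runs M x W d k" "runs M x W e l"
  shows "runs M x W c (k + l)"
proof -
  have "runs M x W c (\<Sum>c'\<in>{d, e}. if c' = d then k else l)"
    using assms by (intro runs_step) auto
  then show ?thesis using \<open>d \<noteq> e\<close> by simp
qed

text \<open>The accepting paths of the machine when it is started in the configuration \<open>c\<close>.\<close>

definition accepting_paths_from ::
  "('q, 'g) ntm \<Rightarrow> bool list \<Rightarrow> ('q, 'g) config \<Rightarrow> ('q, 'g) config list set" where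
  "accepting_paths_from M x c = {p. p \<noteq> [] \<and> hd p = c \<and> successively (step M x) p \<and>
     (\<nexists>c'. step M x (last p) c') \<and> state (last p) \<in> accepting M}"

lemma accepting_paths_from_halt:
  assumes "\<nexists>c'. step M x c c'"
  shows "accepting_paths_from M x c = (if state c \<in> accepting M then {[c]} else {})"
proof -
  have "p = [c]" if "p \<noteq> []" "hd p = c" "successively (step M x) p" for p
    using that assms by (cases p; cases "tl p") auto
  moreover have "successively (step M x) [c]" by simp
  ultimately have "{p. p \<noteq> [] \<and> hd p = c \<and> successively (step M x) p} = {[c]}" by force
  then have "accepting_paths_from M x c = {p \<in> {[c]}. (\<nexists>c'. step M x (last p) c') \<and>
      state (last p) \<in> accepting M}"
    unfolding accepting_paths_from_def by blast
  then show ?thesis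
    using assms by auto
qed

lemma accepting_paths_from_step:
  assumes "{c'. step M x c c'} = S" "S \<noteq> {}"
  shows "accepting_paths_from M x c = (\<Union>c'\<in>S. (#) c ` accepting_paths_from M x c')"
proof (intro equalityI subsetI)
  fix p assume p: "p \<in> accepting_paths_from M x c"
  then obtain p' where p': "p = c # p'"
    by (cases p) (auto simp: accepting_paths_from_def)
  have "p' \<noteq> []"
    using p assms by (auto simp: p' accepting_paths_from_def)
  then obtain c' p'' where "p' = c' # p''" by (cases p') auto
  with p have "step M x c c'" "p' \<in> accepting_paths_from M x c'"
    by (simp_all add: p' accepting_paths_from_def)
  then show "p \<in> (\<Union>c'\<in>S. (#) c ` accepting_paths_from M x c')"
    using assms(1) by (auto simp: p')
next
  fix p assume "p \<in> (\<Union>c'\<in>S. (#) c ` accepting_paths_from M x c')"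
  then obtain c' p' where "c' \<in> S" "p = c # p'" "p' \<in> accepting_paths_from M x c'" by auto
  then show "p \<in> accepting_paths_from M x c"
    using assms(1) by (cases p') (auto simp: accepting_paths_from_def)
qed

lemma runs_card:
  assumes "runs M x W c k"
  shows "finite (accepting_paths_from M x c) \<and> card (accepting_paths_from M x c) = k"
  using assms
proof induction
  case (runs_halt c)
  then show ?case by (simp add: accepting_paths_from_halt)
next
  case (runs_step c S f)
  let ?A = "\<lambda>c'. (#) c ` accepting_paths_from M x c'"
  have "?A d \<inter> ?A e = {}" if "d \<noteq> e" for d e
    using that by (auto simp: accepting_paths_from_def)
  then have "card (\<Union>c'\<in>S. ?A c') = (\<Sum>c'\<in>S. card (?A c'))"
    using runs_step.IH \<open>finite S\<close> by (intro card_UN_disjoint) auto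
  also have "\<dots> = sum f S"
    using runs_step.IH by (intro sum.cong) (auto simp: card_image)
  finally show ?case
    using runs_step.IH \<open>finite S\<close>
    by (simp add: accepting_paths_from_step[OF runs_step.hyps(2,3)])
qed

lemma runs_terminate:
  assumes "runs M x W c k"
  shows "r 0 = c \<Longrightarrow> \<exists>i. \<not> step M x (r i) (r (Suc i))"
  using assms
proof (induction arbitrary: r)
  case (runs_halt c)
  then show ?case by metis
next
  case (runs_step c S f)
  show ?case
  proof (cases "step M x (r 0) (r 1)")
    case True
    then have "r 1 \<in> S" using runs_step by auto
    from runs_step.IH[OF this, of "\<lambda>i. r (Suc i)"] show ?thesis by auto
  qed auto
qed

lemma runs_work_pos:
  assumes "runs M x W c k"
  shows "hd p = c \<Longrightarrow> successively (step M x) p \<Longrightarrow> work_pos ` set p \<subseteq> W"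
  using assms
proof (induction arbitrary: p)
  case (runs_halt c)
  then show ?case by (cases p; cases "tl p") auto
next
  case (runs_step c S f)
  show ?case
  proof (cases p)
    case (Cons c0 p')
    show ?thesis
    proof (cases p')
      case Nil
      with Cons runs_step show ?thesis by auto
    next
      case (Cons c1 p'')
      with \<open>p = c0 # p'\<close> runs_step have "c1 \<in> S" by auto
      from runs_step.IH[OF this, of p'] Cons \<open>p = c0 # p'\<close> runs_step show ?thesis by auto
    qed
  qed simp
qed

subsection \<open>Renaming states and work symbols\<close>

text \<open>
  Machines with arbitrary countable types of states and work symbols are turned into machines over
  the natural numbers by an injective renaming, which preserves runs.
\<close>

definition rename :: "('q \<Rightarrow> 'r) \<Rightarrow> ('g \<Rightarrow> 'h) \<Rightarrow> ('q, 'g) ntm \<Rightarrow> ('r, 'h) ntm" where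
  "rename f g M = \<lparr>start = f (start M), accepting = f ` accepting M, blank = g (blank M),
     transitions = (\<lambda>(q, a, s, q', s', d, e). (f q, a, g s, f q', g s', d, e)) ` transitions M\<rparr>"

definition rename_config :: "('q \<Rightarrow> 'r) \<Rightarrow> ('g \<Rightarrow> 'h) \<Rightarrow> ('q, 'g) config \<Rightarrow> ('r, 'h) config" where
  "rename_config f g c = \<lparr>state = f (state c), input_pos = input_pos c, work_pos = work_pos c,
     work_tape = g \<circ> work_tape c\<rparr>"

lemma inj_rename_config:
  assumes "inj f" "inj g"
  shows "inj (rename_config f g)"
proof (rule injI)
  fix c d :: "('a, 'c) config"
  assume eq: "rename_config f g c = rename_config f g d"
  then have "g \<circ> work_tape c = g \<circ> work_tape d" "f (state c) = f (state d)"
    "input_pos c = input_pos d" "work_pos c = work_pos d"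
    by (simp_all add: rename_config_def)
  then show "c = d"
    using assms by (auto intro!: config.equality simp: fun_eq_iff inj_eq)
qed

lemma step_rename:
  assumes "inj f" "inj g"
  shows "{c'. step (rename f g M) x (rename_config f g c) c'} =
    rename_config f g ` {c'. step M x c c'}"
proof (intro equalityI subsetI)
  fix c' assume "c' \<in> {c'. step (rename f g M) x (rename_config f g c) c'}"
  then obtain q' s' d e where
    tr: "(state c, input_tape x ! nat (input_pos c), work_tape c (work_pos c), q', s', d, e)
      \<in> transitions M" and
    c': "c' = \<lparr>state = f q', input_pos = input_pos c + shift d, work_pos = work_pos c + shift e,
      work_tape = (g \<circ> work_tape c)(work_pos c := g s')\<rparr>"
    using assms by (auto simp: step_def rename_def rename_config_def inj_eq)
  let ?c = "\<lparr>state = q', input_pos = input_pos c + shift d, work_pos = work_pos c + shift e,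
           work_tape = (work_tape c)(work_pos c := s')\<rparr>"
  have "step M x c ?c"
    using tr by (auto simp: step_def)
  moreover have "c' = rename_config f g ?c"
    by (auto simp: c' rename_config_def)
  ultimately show "c' \<in> rename_config f g ` {c'. step M x c c'}" by blast
next
  fix c' assume "c' \<in> rename_config f g ` {c'. step M x c c'}"
  then obtain q' s' d e where
    tr: "(state c, input_tape x ! nat (input_pos c), work_tape c (work_pos c), q', s', d, e)
      \<in> transitions M" and
    c': "c' = \<lparr>state = f q', input_pos = input_pos c + shift d, work_pos = work_pos c + shift e,
      work_tape = (g \<circ> work_tape c)(work_pos c := g s')\<rparr>"
    by (auto simp: step_def rename_config_def fun_upd_comp)
  have "(f (state c), input_tape x ! nat (input_pos c), g (work_tape c (work_pos c)),
      f q', g s', d, e) \<in> transitions (rename f g M)"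
    using tr by (force simp: rename_def)
  then show "c' \<in> {c'. step (rename f g M) x (rename_config f g c) c'}"
    by (auto simp: step_def c' rename_config_def)
qed

lemma runs_rename:
  assumes "inj f" "inj g" "runs M x W c k"
  shows "runs (rename f g M) x W (rename_config f g c) k"
  using assms(3)
proof induction
  case (runs_halt c)
  have "\<nexists>c'. step (rename f g M) x (rename_config f g c) c'"
    using step_rename[OF assms(1,2), of M x c] runs_halt by auto
  from runs.runs_halt[of _ W, OF _ this] runs_halt show ?case
    using assms(1) by (auto simp: rename_config_def rename_def inj_image_mem_iff)
next
  case (runs_step c S h)
  let ?r = "rename_config f g"
  note inj = inj_rename_config[OF assms(1,2)]
  have "runs (rename f g M) x W (?r c) (sum (h \<circ> inv ?r) (?r ` S))"
    using runs_step inj step_rename[OF assms(1,2), of M x c]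
    by (intro runs.runs_step) (auto simp: rename_config_def[of f g c])
  also have "sum (h \<circ> inv ?r) (?r ` S) = sum h S"
    using inj by (subst sum.reindex) (auto simp: inj_on_def)
  finally show ?case .
qed

lemma initial_rename: "initial (rename f g M) = rename_config f g (initial M)"
  by (auto simp: initial_def rename_def rename_config_def)

lemma wf_rename: "wf_ntm M \<Longrightarrow> wf_ntm (rename f g M)"
  by (fastforce simp: wf_ntm_def rename_def)

text \<open>
  The space bound: a machine that stays within \<open>{-1..K}\<close>, where \<open>K\<close> is the length of the binary
  expansion of \<open>|x| \<ge> 1\<close>, visits at most \<open>K + 2 \<le> log 2 |x| + 3\<close> cells.
\<close>

lemma log_bound_bigo: "(\<lambda>n. log 2 (real n) + 3) \<in> O(\<lambda>n. ln (real n))"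
proof (rule bigoI)
  show "eventually (\<lambda>n. norm (log 2 (real n) + 3) \<le> (4 / ln 2) * norm (ln (real n))) at_top"
    using eventually_ge_at_top[of 2]
  proof eventually_elim
    case (elim n)
    have "ln 2 \<le> ln (real n)" using elim by simp
    moreover have "0 < ln (2::real)" by simp
    ultimately have "\<bar>ln (real n) + 3 * ln 2\<bar> \<le> \<bar>ln (real n)\<bar> * 4" by linarith
    then show ?case
      by (simp add: log_def field_simps)
  qed
qed

text \<open>
  The hypothesis on runs is required for every \<open>K\<close> with \<open>|x| < 2 ^ K\<close>, but only the least one is
  used for the space bound.
\<close>

lemma sharpL_if_runs:
  fixes M :: "('q :: countable, 'g :: countable) ntm"
  assumes "wf_ntm M"
    and runs: "\<And>x K. length x < 2 ^ K \<Longrightarrow> runs M x {-1..int K} (initial M) (f x)"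
  shows "f \<in> sharpL"
proof -
  define N where "N = rename (to_nat :: 'q \<Rightarrow> nat) (to_nat :: 'g \<Rightarrow> nat) M"
  have runsN: "runs N x {-1..int K} (initial N) (f x)" if "length x < 2 ^ K" for x K
    unfolding N_def initial_rename by (intro runs_rename runs that) auto
  have ex: "\<exists>K. length x < 2 ^ K" for x :: "bool list"
    using less_exp by blast
  have "card {p. accepting_path N x p} = f x" for x
  proof -
    obtain K where "length x < 2 ^ K" using ex by blast
    from runs_card[OF runsN[OF this]] have "card (accepting_paths_from N x (initial N)) = f x" by simp
    moreover have "{p. accepting_path N x p} = accepting_paths_from N x (initial N)"
      by (auto simp: accepting_path_def computation_def accepting_paths_from_def)
    ultimately show ?thesis by simp
  qed
  moreover have "always_halts N"
    unfolding always_halts_def using ex runsN runs_terminate by metis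
  moreover have "log_space N"
    unfolding log_space_def
  proof (intro exI conjI allI impI)
    \<comment> \<open>The empty input is treated apart because its length has no meaningful logarithm.\<close>
    let ?s = "\<lambda>n. if n = 0 then 2 else log 2 (real n) + 3"
    show "?s \<in> O(\<lambda>n. ln (real n))"
    proof (rule landau_o.big.in_cong[THEN iffD2, OF _ log_bound_bigo])
      show "eventually (\<lambda>n. ?s n = log 2 (real n) + 3) at_top"
        using eventually_gt_at_top[of 0] by eventually_elim simp
    qed
    fix x p assume comp: "computation N x p"
    have card: "card (work_pos ` set p) \<le> K + 2" if "length x < 2 ^ K" for K
    proof -
      have "work_pos ` set p \<subseteq> {-1..int K}"
        using runs_work_pos[OF runsN[OF that]] comp by (auto simp: computation_def)
      from card_mono[OF _ this] show ?thesis by simp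
    qed
    show "real (card (work_pos ` set p)) \<le> ?s (length x)"
    proof (cases "x = []")
      case True
      then show ?thesis using card[of 0] by simp
    next
      case False
      then obtain k where k: "2 ^ k \<le> length x" "length x < 2 ^ (k + 1)"
        using ex_power_ivl1[of 2 "length x"] by (auto simp: Suc_le_eq)
      have "real k \<le> log 2 (length x)"
        using k(1) False by (subst le_log_iff) (auto simp: powr_realpow simp flip: of_nat_power)
      then show ?thesis
        using card[OF k(2)] False by simp
    qed
  qed
  moreover have "wf_ntm N"
    unfolding N_def by (rule wf_rename) fact
  ultimately show ?thesis
    unfolding sharpL_def by (auto simp: fun_eq_iff intro!: exI[of _ N])
qed

section \<open>Counter programs\<close>

text \<open>
  Programs are functions from labels \<open>'s\<close> to instructions, and they act on natural-number counters
  indexed by \<open>'k\<close>. \<open>Inc i t\<close> increments counter \<open>i\<close> and goes to \<open>t\<close>. \<open>Dec i t u\<close> decrements counter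
  \<open>i\<close> and goes to \<open>t\<close> if the counter is positive, and goes to \<open>u\<close> if it is zero. \<open>Read t u w\<close> goes to \<open>t\<close> or
  \<open>u\<close> according to the next input letter, passing over it, and goes to \<open>w\<close> at the end of the input.
  \<open>Fork t u\<close> branches nondeterministically, and \<open>Halt acc\<close> stops and accepts iff \<open>acc\<close> is true.
\<close>

datatype ('s, 'k) instr =
    Inc 'k 's
  | Dec 'k 's 's
  | Read 's 's 's
  | Fork 's 's
  | Halt bool

text \<open>
  The states of the machine that executes a program. In state \<open>At s\<close> the work head is on cell \<open>0\<close> and
  the instruction at \<open>s\<close> comes next. \<open>Carry i t\<close> propagates a carry to the right along track \<open>i\<close>, \<open>Seek i t u\<close>
  moves right to the lowest digit \<open>1\<close> of track \<open>i\<close>, or to the first blank if there is none, and \<open>Borrow i t\<close> moves left and sets the digits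
  of track \<open>i\<close> to \<open>1\<close>. \<open>Home t\<close> moves back to cell \<open>0\<close>, which is recognised by the blank cell to its left.
\<close>

datatype ('s, 'k) control =
    At 's
  | Carry 'k 's
  | Seek 'k 's 's
  | Borrow 'k 's
  | Home 's

instance dir :: finite
proof
  have "(UNIV :: dir set) = {MoveLeft, Stay, MoveRight}"
    by (auto intro: dir.exhaust)
  then show "finite (UNIV :: dir set)" by (metis finite.emptyI finite.insertI)
qed

instance input_symbol :: finite
proof
  have "(UNIV :: input_symbol set) \<subseteq> {LeftEnd, RightEnd} \<union> range Bit"
    by (auto intro: input_symbol.exhaust)
  then show "finite (UNIV :: input_symbol set)" by (rule finite_subset) auto
qed

instance control :: (finite, finite) finite
proof
  have "(UNIV :: ('a, 'b) control set) \<subseteq> range At \<union> range (\<lambda>(i, s). Carry i s) \<union>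
      range (\<lambda>(i, s, t). Seek i s t) \<union> range (\<lambda>(i, s). Borrow i s) \<union> range Home"
  proof
    fix c :: "('a, 'b) control"
    show "c \<in> range At \<union> range (\<lambda>(i, s). Carry i s) \<union>
      range (\<lambda>(i, s, t). Seek i s t) \<union> range (\<lambda>(i, s). Borrow i s) \<union> range Home"
      by (cases c) (auto simp: image_iff)
  qed
  then show "finite (UNIV :: ('a, 'b) control set)" by (rule finite_subset) auto
qed

text \<open>
  A work cell is \<open>None\<close> if it is blank; otherwise it is the set of those counters whose digit in
  that position is \<open>1\<close>. On the left end marker, \<open>Read\<close> first steps to the first letter.
\<close>

fun moves :: "('s \<Rightarrow> ('s, 'k) instr) \<Rightarrow> ('s, 'k) control \<Rightarrow> input_symbol \<Rightarrow> 'k set option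
    \<Rightarrow> (('s, 'k) control \<times> 'k set option \<times> dir \<times> dir) set" where
  "moves P (At s) a g = (case P s of
      Inc i t \<Rightarrow> {(Carry i t, g, Stay, Stay)}
    | Dec i t u \<Rightarrow> {(Seek i t u, g, Stay, Stay)}
    | Read t u w \<Rightarrow> (case a of
          LeftEnd \<Rightarrow> {(At s, g, MoveRight, Stay)}
        | Bit b \<Rightarrow> {(At (if b then t else u), g, MoveRight, Stay)}
        | RightEnd \<Rightarrow> {(At w, g, Stay, Stay)})
    | Fork t u \<Rightarrow> {(At t, g, Stay, Stay), (At u, g, Stay, Stay)}
    | Halt _ \<Rightarrow> {})"
| "moves P (Carry i t) a None = {(Home t, Some {i}, Stay, MoveLeft)}"
| "moves P (Carry i t) a (Some X) =
    (if i \<in> X then {(Carry i t, Some (X - {i}), Stay, MoveRight)}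
     else {(Home t, Some (insert i X), Stay, MoveLeft)})"
| "moves P (Seek i t u) a None = {(Home u, None, Stay, MoveLeft)}"
| "moves P (Seek i t u) a (Some X) =
    (if i \<in> X then {(Borrow i t, Some (X - {i}), Stay, MoveLeft)}
     else {(Seek i t u, Some X, Stay, MoveRight)})"
| "moves P (Borrow i t) a None = {(At t, None, Stay, MoveRight)}"
| "moves P (Borrow i t) a (Some X) = {(Borrow i t, Some (insert i X), Stay, MoveLeft)}"
| "moves P (Home t) a None = {(At t, None, Stay, MoveRight)}"
| "moves P (Home t) a (Some X) = {(Home t, Some X, Stay, MoveLeft)}"

text \<open>The machine that executes the program \<open>P\<close> from the label \<open>s0\<close>.\<close>

definition machine ::
  "('s \<Rightarrow> ('s, 'k) instr) \<Rightarrow> 's \<Rightarrow> (('s, 'k) control, 'k set option) ntm" where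
  "machine P s0 = \<lparr>start = At s0, accepting = {At s | s. P s = Halt True}, blank = None,
     transitions = {(q, a, g, r). r \<in> moves P q a g}\<rparr>"

lemma wf_machine:
  fixes P :: "'s :: finite \<Rightarrow> ('s, 'k :: finite) instr"
  shows "wf_ntm (machine P s0)"
proof -
  have "(a = LeftEnd \<longrightarrow> d \<noteq> MoveLeft) \<and> (a = RightEnd \<longrightarrow> d \<noteq> MoveRight)"
    if "(q', g', d, e) \<in> moves P q a g" for q a g q' g' d e
    using that by (cases "(P, q, a, g)" rule: moves.cases)
      (auto split: instr.splits input_symbol.splits if_splits)
  then show ?thesis
    by (auto simp: wf_ntm_def machine_def)
qed

abbreviation cfg :: "'q \<Rightarrow> int \<Rightarrow> int \<Rightarrow> (int \<Rightarrow> 'g) \<Rightarrow> ('q, 'g) config" where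
  "cfg q h w t \<equiv> \<lparr>state = q, input_pos = h, work_pos = w, work_tape = t\<rparr>"

lemma step_machine:
  "{c'. step (machine P s0) x (cfg q h w t) c'} =
    (\<lambda>(q', g', d, e). cfg q' (h + shift d) (w + shift e) (t(w := g'))) `
      moves P q (input_tape x ! nat h) (t w)"
  by (force simp: step_def machine_def)

lemma runs_machine_det:
  assumes "w \<in> W" "moves P q (input_tape x ! nat h) (t w) = {(q', g', d, e)}"
    "runs (machine P s0) x W (cfg q' (h + shift d) (w + shift e) (t(w := g'))) k"
  shows "runs (machine P s0) x W (cfg q h w t) k"
  using assms by - (rule runs_unique_successor[OF _ _ assms(3)], simp_all add: step_machine)

subsection \<open>Binary counters\<close>

lemma bit_Suc_nat: "bit (Suc m) p \<longleftrightarrow> bit m p \<noteq> (\<forall>q<p. bit m q)"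
proof (induction p arbitrary: m)
  case 0
  then show ?case by (simp add: bit_0)
next
  case (Suc p)
  show ?case
  proof (cases "even m")
    case True
    then have "Suc m div 2 = m div 2" by presburger
    moreover have "\<not> (\<forall>q<Suc p. bit m q)" using True by (auto simp: bit_0 intro!: exI[of _ 0])
    ultimately show ?thesis by (simp add: bit_Suc)
  next
    case False
    then have "Suc m div 2 = Suc (m div 2)" by presburger
    moreover have "(\<forall>q<Suc p. bit m q) \<longleftrightarrow> (\<forall>q<p. bit (m div 2) q)"
      using False by (auto simp: less_Suc_eq_0_disj bit_0 bit_Suc)
    ultimately show ?thesis by (simp add: bit_Suc Suc)
  qed
qed

lemma bit_pred_nat:
  fixes m :: nat
  assumes "0 < m"
  shows "bit (m - 1) p \<longleftrightarrow> bit m p \<noteq> (\<forall>q<p. \<not> bit m q)"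
proof -
  have "(\<forall>q<p. bit n q) \<longleftrightarrow> (\<forall>q<p. \<not> bit (Suc n) q)" for n p
  proof (induction p)
    case (Suc p)
    then show ?case by (auto simp: less_Suc_eq bit_Suc_nat[of n p])
  qed simp
  with assms bit_Suc_nat[of "m - 1" p] show ?thesis by (cases m) auto
qed

lemma bit_nat_le: "bit (m :: nat) p \<Longrightarrow> 2 ^ p \<le> m"
  by (rule ccontr) (simp add: bit_iff_odd)

lemma no_bits_nat: "(\<And>p. \<not> bit (m :: nat) p) \<Longrightarrow> m = 0"
  by (simp add: bit_eq_iff)

text \<open>
  All counters of \<open>v\<close> have at most \<open>L\<close> binary digits, and \<open>tape L v\<close> holds these digits, least
  significant first, in the cells \<open>0, ..., L - 1\<close>. All other cells are blank.
\<close>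

definition fits :: "nat \<Rightarrow> ('k \<Rightarrow> nat) \<Rightarrow> bool" where
  "fits L v \<longleftrightarrow> (\<forall>i p. bit (v i) p \<longrightarrow> p < L)"

definition tape :: "nat \<Rightarrow> ('k \<Rightarrow> nat) \<Rightarrow> int \<Rightarrow> 'k set option" where
  "tape L v p = (if 0 \<le> p \<and> p < int L then Some {i. bit (v i) (nat p)} else None)"

context
  fixes P :: "'s \<Rightarrow> ('s, 'k) instr" and s0 :: 's and x :: "bool list" and K :: nat
begin

abbreviation (input) runs_here where
  "runs_here \<equiv> runs (machine P s0) x {-1..int K}"

lemma runs_Home:
  assumes "runs_here (cfg (At t) h 0 (tape L v)) k" "L \<le> K" "p \<le> L"
  shows "runs_here (cfg (Home t) h (int p - 1) (tape L v)) k"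
  using assms(3)
proof (induction p)
  case 0
  have "tape L v (-1) = None" by (simp add: tape_def)
  then show ?case
    by - (rule runs_machine_det[where g' = None], use assms in \<open>auto simp: fun_upd_idem\<close>)
next
  case (Suc p)
  then have "runs_here (cfg (Home t) h (int p - 1) (tape L v)) k" by simp
  moreover have "tape L v (int p) = Some {i. bit (v i) p}"
    using Suc.prems by (simp add: tape_def)
  ultimately show ?case
    by - (rule runs_machine_det[where g' = "tape L v (int p)"],
      use assms Suc.prems in \<open>auto simp: fun_upd_idem\<close>)
qed

text \<open>
  During an increment, the cells to the left of the head already hold the new value. If the carry
  leaves the used part of the tape, this part grows by one cell, and it stays within the first \<open>K\<close>
  cells because the new value is below \<open>2 ^ K\<close>.
\<close>

lemma runs_Carry:
  fixes v :: "'k \<Rightarrow> nat"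
  defines "v' \<equiv> \<lambda>i. v(i := Suc (v i))"
  assumes cont: "\<And>L. L \<le> K \<Longrightarrow> fits L (v' i) \<Longrightarrow> runs_here (cfg (At t) h 0 (tape L (v' i))) k"
    and "L \<le> K" "fits L v" "Suc (v i) < 2 ^ K" "p \<le> L" "\<forall>q<p. bit (v i) q"
  shows "runs_here (cfg (Carry i t) h (int p)
    (\<lambda>q. if q < int p then tape L (v' i) q else tape L v q)) k"
  using assms(6,7)
proof (induction p rule: inc_induct)
  case base
  have bL: "bit (v' i i) L"
    using base assms(4) by (auto simp: v'_def bit_Suc_nat fits_def)
  have fits': "fits (Suc L) (v' i)"
    unfolding fits_def
  proof (intro allI impI)
    fix j q assume "bit (v' i j) q"
    then have "bit (v j) q \<or> (\<forall>r<q. bit (v i) r)"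
      by (auto simp: v'_def bit_Suc_nat split: if_splits)
    then show "q < Suc L"
      using assms(4) unfolding fits_def by (metis less_Suc_eq less_irrefl_nat linorder_neqE_nat)
  qed
  have "2 ^ L < (2 ^ K :: nat)"
    using bit_nat_le[OF bL] assms(5) unfolding v'_def by (metis fun_upd_same le_less_trans)
  then have "Suc L \<le> K" by simp
  have cell: "{j. bit (v' i j) L} = {i}"
    using bL assms(4) by (auto simp: v'_def fits_def split: if_splits)
  have "(\<lambda>q. if q < int L then tape L (v' i) q else tape L v q)(int L := Some {i}) = tape (Suc L) (v' i)"
    by (auto simp: fun_eq_iff tape_def cell)
  moreover have "runs_here (cfg (Home t) h (int L - 1) (tape (Suc L) (v' i))) k"
    using runs_Home[OF cont[OF \<open>Suc L \<le> K\<close> fits'] \<open>Suc L \<le> K\<close>, of L] by simp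
  moreover have "tape L v (int L) = None" by (simp add: tape_def)
  ultimately show ?case
    by - (rule runs_machine_det[where g' = "Some {i}"], use assms(3) in auto)
next
  case (step p)
  let ?T = "\<lambda>p q. if q < int p then tape L (v' i) q else tape L v q"
  have cell: "?T p (int p) = Some {j. bit (v j) p}"
    using step.hyps by (simp add: tape_def)
  show ?case
  proof (cases "bit (v i) p")
    case True
    have "{j. bit (v' i j) p} = {j. bit (v j) p} - {i}"
      using True step.prems by (auto simp: v'_def bit_Suc_nat)
    then have "(?T p)(int p := Some ({j. bit (v j) p} - {i})) = ?T (Suc p)"
      using step.hyps by (auto simp: fun_eq_iff tape_def)
    moreover have "runs_here (cfg (Carry i t) h (int (Suc p)) (?T (Suc p))) k"
      using step True by (auto simp: less_Suc_eq)
    ultimately show ?thesis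
      using cell True assms(3) step.hyps
      by - (rule runs_machine_det[where g' = "Some ({j. bit (v j) p} - {i})"], auto simp: add.commute)
  next
    case False
    have above: "bit (v' i j) q = bit (v j) q" if "p < q" for j q
      using that False by (auto simp: v'_def bit_Suc_nat)
    have here: "{j. bit (v' i j) p} = insert i {j. bit (v j) p}"
      using False step.prems by (auto simp: v'_def bit_Suc_nat)
    have "(?T p)(int p := Some (insert i {j. bit (v j) p})) = tape L (v' i)"
      using step.hyps by (auto simp: fun_eq_iff tape_def here above)
    moreover have "fits L (v' i)"
      unfolding fits_def
    proof (intro allI impI)
      fix j q assume "bit (v' i j) q"
      then show "q < L"
        using above[of q j] assms(4) step.hyps by (cases "p < q") (auto simp: fits_def)
    qed
    then have "runs_here (cfg (Home t) h (int p - 1) (tape L (v' i))) k"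
      using runs_Home[OF cont[OF assms(3)] assms(3), of p] step.hyps by simp
    ultimately show ?thesis
      using cell False assms(3) step.hyps
      by - (rule runs_machine_det[where g' = "Some (insert i {j. bit (v j) p})"], auto)
  qed
qed

text \<open>
  On the way back of a decrement, the cells to the left of and under the head still hold the old
  value \<open>v\<close>, and the cells to its right hold the new value \<open>v'\<close>.
\<close>

lemma runs_Borrow:
  fixes v v' :: "'k \<Rightarrow> nat"
  assumes "runs_here (cfg (At t) h 0 (tape L v')) k" "L \<le> K" "p \<le> L"
    and "\<And>j. j \<noteq> i \<Longrightarrow> v' j = v j" "\<forall>q<p. bit (v' i) q"
  shows "runs_here (cfg (Borrow i t) h (int p - 1)
    (\<lambda>q. if q < int p then tape L v q else tape L v' q)) k"
  using assms(3,5)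
proof (induction p)
  case 0
  have "(\<lambda>q. if q < int 0 then tape L v q else tape L v' q)(-1 := None) = tape L v'"
    by (auto simp: fun_eq_iff tape_def)
  moreover have "tape L v (-1) = None" by (simp add: tape_def)
  ultimately show ?case
    by - (rule runs_machine_det[where g' = None], use assms(1,2) in auto)
next
  case (Suc p)
  let ?T = "\<lambda>p q. if q < int p then tape L v q else tape L v' q"
  have cell: "?T (Suc p) (int p) = Some {j. bit (v j) p}"
    using Suc.prems by (simp add: tape_def)
  have "bit (v' j) p \<longleftrightarrow> j = i \<or> bit (v j) p" for j
    using Suc.prems(2) by (cases "j = i") (simp_all add: assms(4))
  then have "{j. bit (v' j) p} = insert i {j. bit (v j) p}" by auto
  then have "(?T (Suc p))(int p := Some (insert i {j. bit (v j) p})) = ?T p"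
    using Suc.prems by (auto simp: fun_eq_iff tape_def)
  moreover have "runs_here (cfg (Borrow i t) h (int p - 1) (?T p)) k"
    using Suc by auto
  ultimately show ?case
    using cell assms(2) Suc.prems
    by - (rule runs_machine_det[where g' = "Some (insert i {j. bit (v j) p})"], auto)
qed

lemma runs_Seek:
  fixes v :: "'k \<Rightarrow> nat"
  defines "v' \<equiv> \<lambda>i. v(i := v i - 1)"
  assumes pos: "0 < v i \<Longrightarrow> fits L (v' i) \<Longrightarrow> runs_here (cfg (At t) h 0 (tape L (v' i))) k"
    and zero: "v i = 0 \<Longrightarrow> runs_here (cfg (At u) h 0 (tape L v)) k"
    and "L \<le> K" "fits L v" "p \<le> L" "\<forall>q<p. \<not> bit (v i) q"
  shows "runs_here (cfg (Seek i t u) h (int p) (tape L v)) k"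
  using assms(6,7)
proof (induction p rule: inc_induct)
  case base
  have "v i = 0"
    using base assms(5) by (intro no_bits_nat) (auto simp: fits_def)
  then have "runs_here (cfg (Home u) h (int L - 1) (tape L v)) k"
    using runs_Home[OF zero assms(4), of L] by simp
  moreover have "tape L v (int L) = None" by (simp add: tape_def)
  ultimately show ?case
    by - (rule runs_machine_det[where g' = None], use assms(4) in \<open>auto simp: fun_upd_idem\<close>)
next
  case (step p)
  have cell: "tape L v (int p) = Some {j. bit (v j) p}"
    using step.hyps by (simp add: tape_def)
  show ?case
  proof (cases "bit (v i) p")
    case False
    then have "runs_here (cfg (Seek i t u) h (int (Suc p)) (tape L v)) k"
      using step by (auto simp: less_Suc_eq)
    then show ?thesis
      using cell False assms(4) step.hyps
      by - (rule runs_machine_det[where g' = "Some {j. bit (v j) p}"],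
        auto simp: add.commute fun_upd_idem)
  next
    case True
    then have "0 < v i" by (cases "v i") auto
    have above: "bit (v' i j) q = bit (v j) q" if "p < q" for j q
      using that True bit_pred_nat[OF \<open>0 < v i\<close>] by (auto simp: v'_def)
    have here: "{j. bit (v' i j) p} = {j. bit (v j) p} - {i}"
      using True step.prems bit_pred_nat[OF \<open>0 < v i\<close>] by (auto simp: v'_def)
    have below: "bit (v' i i) q" if "q < p" for q
      using that step.prems bit_pred_nat[OF \<open>0 < v i\<close>] by (auto simp: v'_def)
    have "fits L (v' i)"
      unfolding fits_def
    proof (intro allI impI)
      fix j q assume "bit (v' i j) q"
      then show "q < L"
        using above[of q j] assms(5) step.hyps by (cases "p < q") (auto simp: fits_def)
    qed
    let ?T = "\<lambda>q. if q < int p then tape L v q else tape L (v' i) q"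
    have "(tape L v)(int p := Some ({j. bit (v j) p} - {i})) = ?T"
      using step.hyps by (auto simp: fun_eq_iff tape_def here above)
    moreover have "runs_here (cfg (Borrow i t) h (int p - 1) ?T) k"
      using pos[OF \<open>0 < v i\<close> \<open>fits L (v' i)\<close>] assms(4) step.hyps below
      by (intro runs_Borrow) (auto simp: v'_def)
    ultimately show ?thesis
      using cell True assms(4) step.hyps
      by - (rule runs_machine_det[where g' = "Some ({j. bit (v j) p} - {i})"], auto)
  qed
qed

subsection \<open>Counting the runs of a program\<close>

text \<open>
  Executed from label \<open>s\<close> with the input head at \<open>h\<close> and counter values \<open>v\<close>, the program has exactly
  \<open>k\<close> accepting paths and all of its paths halt within the cells \<open>-1, ..., K\<close>. This is required for every
  number \<open>L\<close> of used cells, since that number depends on the history of the computation.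
\<close>

definition counts :: "'s \<Rightarrow> int \<Rightarrow> ('k \<Rightarrow> nat) \<Rightarrow> nat \<Rightarrow> bool" where
  "counts s h v k \<longleftrightarrow> (\<forall>L\<le>K. fits L v \<longrightarrow> runs_here (cfg (At s) h 0 (tape L v)) k)"

lemma counts_Inc:
  assumes "P s = Inc i t" "Suc (v i) < 2 ^ K" "counts t h (v(i := Suc (v i))) k"
  shows "counts s h v k"
  unfolding counts_def
proof (intro allI impI)
  fix L assume "L \<le> K" "fits L v"
  let ?T = "\<lambda>q. if q < int 0 then tape L (v(i := Suc (v i))) q else tape L v q"
  have "runs_here (cfg (Carry i t) h (int 0) ?T) k"
    using \<open>L \<le> K\<close> \<open>fits L v\<close> assms by (intro runs_Carry) (auto simp: counts_def)
  also have "?T = tape L v"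
    by (auto simp: fun_eq_iff tape_def)
  finally show "runs_here (cfg (At s) h 0 (tape L v)) k"
    by - (rule runs_machine_det[where g' = "tape L v 0"], auto simp: assms(1))
qed

lemma counts_Dec:
  assumes "P s = Dec i t u" "0 < v i \<Longrightarrow> counts t h (v(i := v i - 1)) k" "v i = 0 \<Longrightarrow> counts u h v k"
  shows "counts s h v k"
  unfolding counts_def
proof (intro allI impI)
  fix L assume "L \<le> K" "fits L v"
  then have "runs_here (cfg (Seek i t u) h (int 0) (tape L v)) k"
    using assms(2,3) by (intro runs_Seek) (auto simp: counts_def)
  then show "runs_here (cfg (At s) h 0 (tape L v)) k"
    by - (rule runs_machine_det[where g' = "tape L v 0"], auto simp: assms(1))
qed

lemma counts_Read_start:
  assumes "P s = Read t u w" "counts s 1 v k"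
  shows "counts s 0 v k"
  unfolding counts_def
proof (intro allI impI)
  fix L assume "L \<le> K" "fits L v"
  then show "runs_here (cfg (At s) 0 0 (tape L v)) k"
    using assms by - (rule runs_machine_det[where g' = "tape L v 0"],
      auto simp: counts_def input_tape_def)
qed

text \<open>
  The letter after the prefix \<open>y\<close> of the input is at position \<open>|y| + 1\<close>, as the left end marker is
  at position \<open>0\<close>.
\<close>

lemma counts_Read_bit:
  assumes "P s = Read t u w" "x = y @ b # z"
    "counts (if b then t else u) (int (length y) + 2) v k"
  shows "counts s (int (length y) + 1) v k"
  unfolding counts_def
proof (intro allI impI)
  fix L assume "L \<le> K" "fits L v"
  moreover have "input_tape x ! nat (int (length y) + 1) = Bit b"
    by (simp add: assms(2) input_tape_def nth_append nat_add_distrib)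
  ultimately show "runs_here (cfg (At s) (int (length y) + 1) 0 (tape L v)) k"
    using assms(1,3) by - (rule runs_machine_det[where g' = "tape L v 0"],
      auto simp: counts_def add.commute)
qed

lemma counts_Read_end:
  assumes "P s = Read t u w" "counts w (int (length x) + 1) v k"
  shows "counts s (int (length x) + 1) v k"
  unfolding counts_def
proof (intro allI impI)
  fix L assume "L \<le> K" "fits L v"
  then show "runs_here (cfg (At s) (int (length x) + 1) 0 (tape L v)) k"
    using assms by - (rule runs_machine_det[where g' = "tape L v 0"],
      auto simp: counts_def input_tape_def nth_append nat_add_distrib)
qed

lemma counts_Fork:
  assumes "P s = Fork t u" "t \<noteq> u" "counts t h v k" "counts u h v l"
  shows "counts s h v (k + l)"
  unfolding counts_def
proof (intro allI impI)
  fix L assume "L \<le> K" "fits L v"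
  then show "runs_here (cfg (At s) h 0 (tape L v)) (k + l)"
    using assms by - (rule runs_two_successors[of _ _ _ _
      "cfg (At t) h 0 (tape L v)" "cfg (At u) h 0 (tape L v)"],
      auto simp: counts_def step_machine)
qed

lemma counts_Halt:
  assumes "P s = Halt b"
  shows "counts s h v (if b then 1 else 0)"
  unfolding counts_def
proof (intro allI impI)
  fix L
  have "\<nexists>c'. step (machine P s0) x (cfg (At s) h 0 (tape L v)) c'"
    using step_machine[of P s0 x "At s" h 0 "tape L v"] by (auto simp: assms)
  from runs_halt[of _ "{-1..int K}", OF _ this]
  show "runs_here (cfg (At s) h 0 (tape L v)) (if b then 1 else 0)"
    by (simp add: machine_def assms)
qed

end

lemma sharpL_if_counts:
  fixes P :: "'s :: finite \<Rightarrow> ('s, 'k :: finite) instr"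
  assumes "\<And>x K. length x < 2 ^ K \<Longrightarrow> counts P s0 x K s0 0 (\<lambda>_. 0) (f x)"
  shows "f \<in> sharpL"
proof (rule sharpL_if_runs[OF wf_machine])
  fix x :: "bool list" and K :: nat
  assume "length x < 2 ^ K"
  from assms[OF this] have "runs (machine P s0) x {-1..int K} (cfg (At s0) 0 0 (tape 0 (\<lambda>_. 0))) (f x)"
    unfolding counts_def by (auto simp: fits_def)
  also have "cfg (At s0) 0 0 (tape 0 (\<lambda>_. 0)) = initial (machine P s0)"
    by (auto simp: initial_def machine_def tape_def)
  finally show "runs (machine P s0) x {-1..int K} (initial (machine P s0)) (f x)" .
qed

section \<open>Two recursions and their closed forms\<close>

text \<open>
  The number of pairs of binary words of length \<open>n\<close> with \<open>a\<close> and \<open>a + y\<close> ones in which every suffix of the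
  second word has at least as many ones as the corresponding suffix of the first word. The
  recursion removes the first letters; the four terms belong to the letters \<open>(0, 0)\<close>, \<open>(0, 1)\<close>,
  \<open>(1, 0)\<close> and \<open>(1, 1)\<close> in this order.
\<close>

fun dominating_pairs :: "nat \<Rightarrow> nat \<Rightarrow> nat \<Rightarrow> nat" where
  "dominating_pairs 0 a y = (if a = 0 \<and> y = 0 then 1 else 0)"
| "dominating_pairs (Suc n) a y =
     (dominating_pairs n a y + (if y = 0 then 0 else dominating_pairs n a (y - 1))) +
     (if a = 0 then 0 else dominating_pairs n (a - 1) (Suc y) + dominating_pairs n (a - 1) y)"

lemma dominating_pairs_eq:
  "int (dominating_pairs n a y) = int (n choose a) * int (n choose (a + y)) -
     (if a = 0 then 0 else int (n choose (a - 1)) * int (n choose (a + y + 1)))"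
proof (induction n arbitrary: a y)
  case 0
  then show ?case by (cases a; cases y) auto
next
  case (Suc n)
  show ?case
    unfolding dominating_pairs.simps of_nat_add if_distrib[of int] Suc.IH
    by (cases a; cases "a - 1"; cases y) (simp_all add: algebra_simps)
qed

text \<open>
  \<open>tableaux n a y\<close> is the number of semistandard Young tableaux of shape \<open>(a + y, a)\<close> over the letters
  \<open>0, ..., n\<close>, and \<open>tableaux' n a y\<close> is the number of those of the same shape over \<open>0, ..., n + 1\<close> in which
  the largest letter does not occur in the first row. The recursion deletes an occurrence of the
  largest letter at the end of the first row, which must stay as long as the second one, and then at
  the end of the second row, or decides that no further occurrence is there.
\<close>

fun tableaux and tableaux' :: "nat \<Rightarrow> nat \<Rightarrow> nat \<Rightarrow> nat" where
  "tableaux 0 a y = (if a = 0 then 1 else 0)"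
| "tableaux (Suc n) a y = (if y = 0 then 0 else tableaux (Suc n) a (y - 1)) + tableaux' n a y"
| "tableaux' n a y = tableaux n a y + (if a = 0 then 0 else tableaux' n (a - 1) (Suc y))"

lemma tableaux_eq:
  "int (tableaux n a y) = int ((n + a) choose n) * int ((n + a + y) choose n) -
     (if a = 0 then 0 else int ((n + a - 1) choose n) * int ((n + a + y + 1) choose n))"
  "int (tableaux' n a y) = int ((Suc n + a) choose Suc n) * int ((n + a + y) choose n) -
     (if a = 0 then 0 else int ((n + a) choose Suc n) * int ((n + a + y + 1) choose n))"
proof (induction n a y and n a y rule: tableaux_tableaux'.induct)
  case (1 a y)
  then show ?case by simp
next
  case (2 n a y)
  then show ?case by (cases a; cases y) (auto simp: algebra_simps)
next
  case (3 n a y)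
  show ?case
  proof (cases a)
    case 0
    then show ?thesis using 3 by (simp add: binomial_eq_0)
  next
    case (Suc b)
    show ?thesis
      using 3(1) 3(2)[unfolded Suc] by (cases b) (simp_all add: Suc algebra_simps)
  qed
qed

(* The right-hand sides contain instances of the left-hand sides, so rewriting would loop. *)
declare tableaux.simps [simp del] tableaux'.simps [simp del]

section \<open>The program\<close>

text \<open>
  After the input \<open>encode n a b\<close> has been read, \<open>Len\<close>, \<open>Ones\<close> and \<open>Gap\<close> hold \<open>n\<close>, \<open>a\<close> and \<open>b - a\<close>. The
  other counters serve the tests: \<open>Room\<close> starts as \<open>n\<close> and \<open>Debt\<close> as \<open>a\<close>, and each letter of the third block
  decrements \<open>Room\<close> and, if it can, \<open>Debt\<close>; the letters for which \<open>Debt\<close> is zero are counted by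
  \<open>Gap\<close>. Hence \<open>b \<le> n\<close> iff \<open>Room\<close> is never decremented at zero, and \<open>a \<le> b\<close> iff \<open>Debt\<close> ends at zero.
\<close>

datatype counter = Len | Ones | Gap | Room | Debt

text \<open>
  Labels: the three blocks of the input with their checks, then the loop for \<open>dominating_pairs\<close>,
  entered at \<open>Pairs\<close>, and the loop for \<open>tableaux\<close>, entered at \<open>Tab\<close>. At \<open>PairsV0\<close> and \<open>PairsV1\<close> the letter
  of the first word has been guessed as \<open>0\<close> or \<open>1\<close>; at \<open>TabRow1\<close> and \<open>TabRow2\<close> the largest letter
  is deleted from the first or second row.
\<close>

datatype phase =
    Block1 | IncLen | IncRoom
  | Block2 | IncOnes | IncDebt
  | Block3 | DecRoom | DecDebt | IncGap
  | CheckDebt | CheckOnes | RestoreOnes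
  | Reject | Accept
  | Pairs | PairsU | PairsV0 | PairsV1 | PairsGapDown | PairsOnesDown | PairsGapUp
  | PairsEnd | PairsEndGap
  | Tab | TabRow1 | TabGapDown | TabRow2 | TabOnesDown | TabGapUp | TabEnd

instance counter :: finite
proof
  have "(UNIV :: counter set) = {Len, Ones, Gap, Room, Debt}"
    by (auto intro: counter.exhaust)
  then show "finite (UNIV :: counter set)" by (metis finite.emptyI finite.insertI)
qed

instance phase :: finite
proof
  have "(UNIV :: phase set) = {Block1, IncLen, IncRoom, Block2, IncOnes, IncDebt,
      Block3, DecRoom, DecDebt, IncGap, CheckDebt, CheckOnes, RestoreOnes, Reject, Accept,
      Pairs, PairsU, PairsV0, PairsV1, PairsGapDown, PairsOnesDown, PairsGapUp, PairsEnd, PairsEndGap,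
      Tab, TabRow1, TabGapDown, TabRow2, TabOnesDown, TabGapUp, TabEnd}"
    using phase.nchotomy by (intro UNIV_eq_I) (simp only: insert_iff empty_iff, metis)
  then show "finite (UNIV :: phase set)" by (metis finite.emptyI finite.insertI)
qed

text \<open>The counter values, listed in the order of the constructors.\<close>

primrec vals :: "nat \<Rightarrow> nat \<Rightarrow> nat \<Rightarrow> nat \<Rightarrow> nat \<Rightarrow> counter \<Rightarrow> nat" where
  "vals n a y m c Len = n"
| "vals n a y m c Ones = a"
| "vals n a y m c Gap = y"
| "vals n a y m c Room = m"
| "vals n a y m c Debt = c"

lemma vals_upd [simp]:
  "(vals n a y m c)(Len := z) = vals z a y m c"
  "(vals n a y m c)(Ones := z) = vals n z y m c"
  "(vals n a y m c)(Gap := z) = vals n a z m c"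
  "(vals n a y m c)(Room := z) = vals n a y z c"
  "(vals n a y m c)(Debt := z) = vals n a y m z"
  by (rule ext, rename_tac i, case_tac i; simp)+

text \<open>The parameter \<open>b\<close> is the label at which the program continues after a valid input.\<close>

primrec program :: "phase \<Rightarrow> phase \<Rightarrow> (phase, counter) instr" where
  "program b Block1 = Read IncLen Block2 Reject"
| "program b IncLen = Inc Len IncRoom"
| "program b IncRoom = Inc Room Block1"
| "program b Block2 = Read IncOnes Block3 Reject"
| "program b IncOnes = Inc Ones IncDebt"
| "program b IncDebt = Inc Debt Block2"
| "program b Block3 = Read DecRoom Reject CheckDebt"
| "program b DecRoom = Dec Room DecDebt Reject"
| "program b DecDebt = Dec Debt Block3 IncGap"
| "program b IncGap = Inc Gap Block3"
| "program b CheckDebt = Dec Debt Reject CheckOnes"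
| "program b CheckOnes = Dec Ones RestoreOnes Reject"
| "program b RestoreOnes = Inc Ones b"
| "program b Reject = Halt False"
| "program b Accept = Halt True"
| "program b Pairs = Dec Len PairsU PairsEnd"
| "program b PairsU = Fork PairsV0 PairsOnesDown"
| "program b PairsV0 = Fork Pairs PairsGapDown"
| "program b PairsGapDown = Dec Gap Pairs Reject"
| "program b PairsOnesDown = Dec Ones PairsV1 Reject"
| "program b PairsV1 = Fork PairsGapUp Pairs"
| "program b PairsGapUp = Inc Gap Pairs"
| "program b PairsEnd = Dec Ones Reject PairsEndGap"
| "program b PairsEndGap = Dec Gap Reject Accept"
| "program b Tab = Dec Len TabRow1 TabEnd"
| "program b TabRow1 = Fork TabGapDown TabRow2"
| "program b TabGapDown = Dec Gap TabRow1 Reject"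
| "program b TabRow2 = Fork Tab TabOnesDown"
| "program b TabOnesDown = Dec Ones TabGapUp Reject"
| "program b TabGapUp = Inc Gap TabRow2"
| "program b TabEnd = Dec Ones Reject Accept"

context
  fixes b :: phase and x :: "bool list" and K :: nat
  assumes K: "length x < 2 ^ K"
begin

abbreviation (input) "cnt \<equiv> counts (program b) Block1 x K"

lemma small: "Suc i \<le> length x \<Longrightarrow> Suc i < 2 ^ K"
  using K by linarith

lemma counts_Accept: "cnt Accept h v 1"
  using counts_Halt[of "program b" Accept True] by simp

lemma counts_Reject: "cnt Reject h v 0"
  using counts_Halt[of "program b" Reject False] by simp

lemma counts_Pairs:
  "a + y \<le> length x \<Longrightarrow> cnt Pairs h (vals n a y m c) (dominating_pairs n a y)"
proof (induction n arbitrary: a y)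
  case 0
  have "cnt PairsEndGap h (vals 0 0 y m c) (if y = 0 then 1 else 0)"
    by (rule counts_Dec) (auto intro: counts_Accept[simplified] counts_Reject)
  then have "cnt PairsEnd h (vals 0 a y m c) (if a = 0 \<and> y = 0 then 1 else 0)"
    by - (rule counts_Dec[of _ PairsEnd], auto intro: counts_Reject)
  then show ?case
    by - (rule counts_Dec[of _ Pairs], auto)
next
  case (Suc n)
  have "cnt PairsGapDown h (vals n a y m c) (if y = 0 then 0 else dominating_pairs n a (y - 1))"
    using Suc by - (rule counts_Dec[of _ PairsGapDown], auto intro: counts_Reject)
  then have u0: "cnt PairsV0 h (vals n a y m c)
      (dominating_pairs n a y + (if y = 0 then 0 else dominating_pairs n a (y - 1)))"
    using Suc by - (rule counts_Fork[of _ PairsV0], auto)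
  have "cnt PairsV1 h (vals n (a - 1) y m c)
      (dominating_pairs n (a - 1) (Suc y) + dominating_pairs n (a - 1) y)" if "a > 0"
  proof -
    have "cnt PairsGapUp h (vals n (a - 1) y m c) (dominating_pairs n (a - 1) (Suc y))"
      using Suc that by - (rule counts_Inc[of _ PairsGapUp], auto intro!: small)
    then show ?thesis
      using Suc that by - (rule counts_Fork[of _ PairsV1], auto)
  qed
  then have u1: "cnt PairsOnesDown h (vals n a y m c)
      (if a = 0 then 0 else dominating_pairs n (a - 1) (Suc y) + dominating_pairs n (a - 1) y)"
    by - (rule counts_Dec[of _ PairsOnesDown], auto intro: counts_Reject)
  have "cnt PairsU h (vals n a y m c) (dominating_pairs (Suc n) a y)"
    unfolding dominating_pairs.simps by (rule counts_Fork[OF _ _ u0 u1]) simp_all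
  then show ?case
    by - (rule counts_Dec[of _ Pairs], auto)
qed

lemma counts_Tab_if_decremented:
  assumes "cnt (if n = 0 then TabEnd else TabRow1) h (vals (n - 1) a y m c) k"
  shows "cnt Tab h (vals n a y m c) k"
  using assms by - (rule counts_Dec[of _ Tab], auto)

text \<open>
  The induction follows the recursion for \<open>tableaux\<close>, whose second equation belongs to the label
  \<open>TabRow1\<close>, at which \<open>Len\<close> has been decremented already.
\<close>

lemma counts_Tab_aux:
  "a + y \<le> length x \<Longrightarrow>
    cnt (if n = 0 then TabEnd else TabRow1) h (vals (n - 1) a y m c) (tableaux n a y)"
  "a + y \<le> length x \<Longrightarrow> cnt TabRow2 h (vals n a y m c) (tableaux' n a y)"
proof (induction n a y and n a y rule: tableaux_tableaux'.induct)
  case (1 a y)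
  have "cnt TabEnd h (vals 0 a y m c) (tableaux 0 a y)"
    by - (rule counts_Dec[of _ TabEnd],
      auto simp: tableaux.simps intro: counts_Reject counts_Accept[simplified])
  then show ?case by simp
next
  case (2 n a y)
  have "cnt TabGapDown h (vals n a y m c) (if y = 0 then 0 else tableaux (Suc n) a (y - 1))"
  proof (rule counts_Dec[of _ TabGapDown])
    assume y: "0 < vals n a y m c Gap"
    then have "cnt TabRow1 h (vals n a (y - 1) m c) (tableaux (Suc n) a (y - 1))"
      using 2(1,3) by simp
    then show "cnt TabRow1 h ((vals n a y m c)(Gap := vals n a y m c Gap - 1))
        (if y = 0 then 0 else tableaux (Suc n) a (y - 1))"
      using y by simp
  qed (auto intro: counts_Reject)
  moreover have "cnt TabRow2 h (vals n a y m c) (tableaux' n a y)"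
    using 2(2,3) .
  ultimately have "cnt TabRow1 h (vals n a y m c) (tableaux (Suc n) a y)"
    unfolding tableaux.simps(2)[of n a y] by (rule counts_Fork[rotated 2]) simp_all
  then show ?case by simp
next
  case (3 n a y)
  have "cnt TabOnesDown h (vals n a y m c) (if a = 0 then 0 else tableaux' n (a - 1) (Suc y))"
  proof (rule counts_Dec[of _ TabOnesDown])
    assume a: "0 < vals n a y m c Ones"
    then have IH: "cnt TabRow2 h (vals n (a - 1) (Suc y) m c) (tableaux' n (a - 1) (Suc y))"
      using 3(2,3) by simp
    have "cnt TabGapUp h (vals n (a - 1) y m c) (tableaux' n (a - 1) (Suc y))"
      by (rule counts_Inc[of _ TabGapUp]) (use a IH 3(3) small[of y] in auto)
    then show "cnt TabGapUp h ((vals n a y m c)(Ones := vals n a y m c Ones - 1))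
        (if a = 0 then 0 else tableaux' n (a - 1) (Suc y))"
      using a by simp
  qed (auto intro: counts_Reject)
  moreover have "cnt Tab h (vals n a y m c) (tableaux n a y)"
    using counts_Tab_if_decremented[OF 3(1)[OF 3(3)]] .
  ultimately show ?case
    unfolding tableaux'.simps[of n a y] by - (rule counts_Fork[of _ TabRow2], auto)
qed

lemma counts_Tab:
  "a + y \<le> length x \<Longrightarrow> cnt Tab h (vals n a y m c) (tableaux n a y)"
  by (intro counts_Tab_if_decremented counts_Tab_aux)

lemma counts_Block1:
  assumes "x = u @ replicate j True @ r" "n + j \<le> length x" "m + j \<le> length x"
    and "cnt Block1 (int (length u + j) + 1) (vals (n + j) a y (m + j) c) k"
  shows "cnt Block1 (int (length u) + 1) (vals n a y m c) k"
  using assms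
proof (induction j arbitrary: u n m)
  case (Suc j)
  have "cnt Block1 (int (length (u @ [True])) + 1) (vals (Suc n) a y (Suc m) c) k"
    using Suc.prems by (intro Suc.IH) simp_all
  then have "cnt IncRoom (int (length u) + 2) (vals (Suc n) a y m c) k"
    using small[of m] Suc.prems(3) by - (rule counts_Inc[of _ IncRoom], auto simp: add.commute)
  then have "cnt IncLen (int (length u) + 2) (vals n a y m c) k"
    using small[of n] Suc.prems(2) by - (rule counts_Inc[of _ IncLen], auto)
  then show ?case
    using Suc.prems by - (rule counts_Read_bit[of _ Block1 _ _ _ _ _ True], simp_all)
qed simp

lemma counts_Block2:
  assumes "x = u @ replicate j True @ r" "a + j \<le> length x" "c + j \<le> length x"
    and "cnt Block2 (int (length u + j) + 1) (vals n (a + j) y m (c + j)) k"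
  shows "cnt Block2 (int (length u) + 1) (vals n a y m c) k"
  using assms
proof (induction j arbitrary: u a c)
  case (Suc j)
  have "cnt Block2 (int (length (u @ [True])) + 1) (vals n (Suc a) y m (Suc c)) k"
    using Suc.prems by (intro Suc.IH) simp_all
  then have "cnt IncDebt (int (length u) + 2) (vals n (Suc a) y m c) k"
    using small[of c] Suc.prems(3) by - (rule counts_Inc[of _ IncDebt], auto simp: add.commute)
  then have "cnt IncOnes (int (length u) + 2) (vals n a y m c) k"
    using small[of a] Suc.prems(2) by - (rule counts_Inc[of _ IncOnes], auto)
  then show ?case
    using Suc.prems by - (rule counts_Read_bit[of _ Block2 _ _ _ _ _ True], simp_all)
qed simp

text \<open>The third block of \<open>j\<close> ones is rejected if it is longer than the value \<open>m\<close> of \<open>Room\<close>.\<close>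

lemma counts_Block3:
  assumes "x = u @ replicate j True @ r" "y + j \<le> length x"
    and "j \<le> m \<Longrightarrow>
      cnt Block3 (int (length u + j) + 1) (vals n a (y + (j - c)) (m - j) (c - j)) k"
  shows "cnt Block3 (int (length u) + 1) (vals n a y m c) (if j \<le> m then k else 0)"
  using assms
proof (induction j arbitrary: u y m c)
  case (Suc j)
  let ?k = "if Suc j \<le> m then k else 0"
  have "cnt DecDebt (int (length u) + 2) (vals n a y (m - 1) c) ?k" if "m > 0"
  proof (rule counts_Dec[of _ DecDebt])
    assume "0 < vals n a y (m - 1) c Debt"
    then have "cnt Block3 (int (length (u @ [True])) + 1) (vals n a y (m - 1) (c - 1))
        (if j \<le> m - 1 then k else 0)"
      using Suc.prems that by (intro Suc.IH) (auto simp: Suc_le_eq)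
    then show "cnt Block3 (int (length u) + 2)
        ((vals n a y (m - 1) c)(Debt := vals n a y (m - 1) c Debt - 1)) ?k"
      using that by (cases m) (simp_all add: add.commute)
  next
    assume c: "vals n a y (m - 1) c Debt = 0"
    then have "cnt Block3 (int (length (u @ [True])) + 1) (vals n a (Suc y) (m - 1) c)
        (if j \<le> m - 1 then k else 0)"
      using Suc.prems that by (intro Suc.IH) (auto simp: Suc_le_eq)
    then have "cnt Block3 (int (length u) + 2) (vals n a (Suc y) (m - 1) c) ?k"
      using that by (cases m) (simp_all add: add.commute)
    then show "cnt IncGap (int (length u) + 2) (vals n a y (m - 1) c) ?k"
      using Suc.prems(2) c small[of y] by - (rule counts_Inc[of _ IncGap], auto)
  qed simp
  then have "cnt DecRoom (int (length u) + 2) (vals n a y m c) ?k"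
    by - (rule counts_Dec[of _ DecRoom], auto intro: counts_Reject)
  then show ?case
    using Suc.prems by - (rule counts_Read_bit[of _ Block3 _ _ _ _ _ True], simp_all)
qed simp

text \<open>The letter \<open>b\<close> being used for the label, \<open>l\<close> is the length of the third block from here on.\<close>

lemma counts_encode:
  assumes "x = encode n a l"
    and body: "\<And>h m c. \<lbrakk>1 \<le> a; a \<le> l; l \<le> n\<rbrakk> \<Longrightarrow> cnt b h (vals n a (l - a) m c) k"
  shows "cnt Block1 0 (\<lambda>_. 0) (if 1 \<le> a \<and> a \<le> l \<and> l \<le> n then k else 0)"
proof -
  let ?k = "if 1 \<le> a \<and> a \<le> l then k else 0"
  have len: "length x = n + a + l + 2"
    by (simp add: assms(1) encode_def)
  have checks: "cnt CheckDebt h (vals n a (l - a) m (a - l)) ?k" if "l \<le> n" for h m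
  proof -
    have "cnt CheckOnes h (vals n a (l - a) m 0) ?k" if "a \<le> l"
    proof (rule counts_Dec[of _ CheckOnes])
      assume "0 < vals n a (l - a) m 0 Ones"
      then have "cnt RestoreOnes h (vals n (a - 1) (l - a) m 0) ?k"
        using that \<open>l \<le> n\<close> len
        by - (rule counts_Inc[of _ RestoreOnes], auto intro!: small body)
      then show "cnt RestoreOnes h ((vals n a (l - a) m 0)(Ones := vals n a (l - a) m 0 Ones - 1)) ?k"
        by simp
    qed (auto intro: counts_Reject)
    then show ?thesis
      by - (rule counts_Dec[of _ CheckDebt], auto intro: counts_Reject)
  qed
  have "cnt Block3 (int (length (replicate n True @ [False] @ replicate a True @ [False])) + 1)
      (vals n a 0 n a) (if l \<le> n then ?k else 0)"
  proof (rule counts_Block3[where r = "[]"])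
    assume "l \<le> n"
    have "cnt Block3 (int (length x) + 1) (vals n a (l - a) (n - l) (a - l)) ?k"
      by (rule counts_Read_end) (use checks[OF \<open>l \<le> n\<close>] in auto)
    then show "cnt Block3 (int (length (replicate n True @ [False] @ replicate a True @ [False]) + l) + 1)
      (vals n a (0 + (l - a)) (n - l) (a - l)) ?k"
      by (simp add: len add_ac)
  qed (use len in \<open>simp_all add: assms(1) encode_def\<close>)
  then have "cnt Block2 (int (length (replicate n True @ [False] @ replicate a True)) + 1)
      (vals n a 0 n a) (if l \<le> n then ?k else 0)"
    by - (rule counts_Read_bit[of _ Block2 _ _ _ _ _ False],
      simp_all add: assms(1) encode_def add_ac)
  then have "cnt Block2 (int (length (replicate n True @ [False])) + 1)
      (vals n 0 0 n 0) (if l \<le> n then ?k else 0)"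
    by (intro counts_Block2[where j = a and r = "False # replicate l True"])
      (use len in \<open>simp_all add: assms(1) encode_def add_ac\<close>)
  then have "cnt Block1 (int (length (replicate n True)) + 1) (vals n 0 0 n 0) (if l \<le> n then ?k else 0)"
    by - (rule counts_Read_bit[of _ Block1 _ _ _ _ _ False],
      simp_all add: assms(1) encode_def add_ac)
  then have "cnt Block1 (int (length ([] :: bool list)) + 1) (vals 0 0 0 0 0) (if l \<le> n then ?k else 0)"
    by (intro counts_Block1[where j = n and r = "False # replicate a True @ False # replicate l True"])
      (use len in \<open>simp_all add: assms(1) encode_def\<close>)
  moreover have "vals 0 0 0 0 0 = (\<lambda>_. 0)"
    by (rule ext, rename_tac i, case_tac i) simp_all
  ultimately show ?thesis
    by - (rule counts_Read_start[of _ Block1], auto split: if_splits)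
qed

lemma counts_not_encode:
  assumes "\<nexists>n a l. x = encode n a l"
  shows "cnt Block1 0 (\<lambda>_. 0) 0"
proof -
  have ones: "\<exists>j r. u = replicate j True @ r \<and> (r = [] \<or> (\<exists>r'. r = False # r'))" for u
  proof (induction u)
    case (Cons c u)
    then obtain j r where jr: "u = replicate j True @ r" "r = [] \<or> (\<exists>r'. r = False # r')" by blast
    show ?case
    proof (cases c)
      case True
      with jr show ?thesis by (intro exI[of _ "Suc j"]) auto
    qed (auto intro!: exI[of _ 0])
  qed simp
  obtain n r where n: "x = replicate n True @ r" "r = [] \<or> (\<exists>r'. r = False # r')"
    using ones by blast
  have "cnt Block1 (int n + 1) (vals n 0 0 n 0) 0"
  proof (cases "r = []")
    case True
    then have "cnt Block1 (int (length x) + 1) (vals n 0 0 n 0) 0"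
      by - (rule counts_Read_end, auto intro: counts_Reject)
    with n True show ?thesis by simp
  next
    case False
    with n obtain r' where r': "x = replicate n True @ False # r'" by auto
    obtain a s where a: "r' = replicate a True @ s" "s = [] \<or> (\<exists>s'. s = False # s')"
      using ones by blast
    have "cnt Block2 (int (length (replicate n True @ [False]) + a) + 1) (vals n (0 + a) 0 n (0 + a)) 0"
    proof (cases "s = []")
      case True
      then have "cnt Block2 (int (length x) + 1) (vals n a 0 n a) 0"
        by - (rule counts_Read_end, auto intro: counts_Reject)
      with r' a True show ?thesis by simp
    next
      case False
      with a r' obtain s' where s': "x = replicate n True @ False # replicate a True @ False # s'"
        by auto
      obtain l t where l: "s' = replicate l True @ t" "t = [] \<or> (\<exists>t'. t = False # t')"
        using ones by blast
      let ?u = "replicate n True @ False # replicate a True @ [False]"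
      have "t \<noteq> []"
      proof
        assume "t = []"
        with s' l have "x = encode n a l" by (simp add: encode_def)
        with assms show False by blast
      qed
      then obtain t' where t: "x = (?u @ replicate l True) @ False # t'"
        using l s' by auto
      have "cnt Block3 (int (length ?u) + 1) (vals n a 0 n a) (if l \<le> n then 0 else 0)"
      proof (rule counts_Block3[where r = t])
        have "cnt Block3 (int (length (?u @ replicate l True)) + 1) (vals n a (0 + (l - a)) (n - l) (a - l)) 0"
          by (rule counts_Read_bit[OF _ t]) (auto intro: counts_Reject)
        then show "cnt Block3 (int (length ?u + l) + 1) (vals n a (0 + (l - a)) (n - l) (a - l)) 0"
          by simp
      qed (use s' l in auto)
      then have "cnt Block2 (int (length (replicate n True @ False # replicate a True)) + 1)
          (vals n a 0 n a) 0"
        using s' by - (rule counts_Read_bit[of _ Block2 _ _ _ _ _ False], simp_all add: add_ac)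
      then show ?thesis by (simp add: add_ac)
    qed
    then have "cnt Block2 (int (length (replicate n True @ [False])) + 1) (vals n 0 0 n 0) 0"
      using r' a by (intro counts_Block2[where j = a and r = s]) auto
    then have "cnt Block1 (int (length (replicate n True)) + 1) (vals n 0 0 n 0) 0"
      using r' by - (rule counts_Read_bit[of _ Block1 _ _ _ _ _ False], simp_all add: add_ac)
    then show ?thesis by simp
  qed
  then have "cnt Block1 (int (length ([] :: bool list)) + 1) (vals 0 0 0 0 0) 0"
    using n(1) by (intro counts_Block1[where j = n and r = r]) auto
  moreover have "vals 0 0 0 0 0 = (\<lambda>_. 0)"
    by (rule ext, rename_tac i, case_tac i) simp_all
  ultimately show ?thesis
    by - (rule counts_Read_start[of _ Block1], auto)
qed

end

lemma encode_inject: "encode n a l = encode n' a' l' \<longleftrightarrow> n = n' \<and> a = a' \<and> l = l'"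
proof -
  have "replicate i True @ False # r = replicate j True @ False # s \<longleftrightarrow> i = j \<and> r = s" for i j r s
  proof (induction i arbitrary: j)
    case 0
    then show ?case by (cases j) auto
  next
    case (Suc i)
    then show ?case by (cases j) auto
  qed
  then show ?thesis by (simp add: encode_def replicate_eq_replicate)
qed

text \<open>
  It is enough that the loop at \<open>b\<close> computes \<open>g\<close>, a function of \<open>n\<close>, \<open>a\<close> and the difference of the
  last two block lengths, whatever the position of the input head and the two auxiliary counters are.
\<close>

lemma sharpL_zero_extension:
  fixes g :: "nat \<Rightarrow> nat \<Rightarrow> nat \<Rightarrow> nat"
  assumes body: "\<And>x K h n a l m c. \<lbrakk>length x < 2 ^ K; l \<le> length x; a \<le> l\<rbrakk>
      \<Longrightarrow> counts (program b) Block1 x K b h (vals n a (l - a) m c) (g n a (l - a))"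
    and g: "\<And>n a l. \<lbrakk>1 \<le> a; a \<le> l; l \<le> n\<rbrakk> \<Longrightarrow> int (g n a (l - a)) = G n a l"
  shows "\<exists>f\<in>sharpL. is_zero_extension G f"
proof -
  define f where "f x = (if \<exists>n a l. 1 \<le> a \<and> a \<le> l \<and> l \<le> n \<and> x = encode n a l
    then THE k. \<exists>n a l. x = encode n a l \<and> k = g n a (l - a) else 0)" for x
  have f: "f (encode n a l) = (if 1 \<le> a \<and> a \<le> l \<and> l \<le> n then g n a (l - a) else 0)" for n a l
    by (simp add: f_def encode_inject)
  have "counts (program b) Block1 x K Block1 0 (\<lambda>_. 0) (f x)" if "length x < 2 ^ K" for x K
  proof (cases "\<exists>n a l. x = encode n a l")
    case True
    then obtain n a l where x: "x = encode n a l" by blast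
    show ?thesis
      unfolding x f
      by (rule counts_encode) (use that in \<open>auto simp: x intro!: body, simp add: encode_def\<close>)
  next
    case False
    then have "f x = 0" by (auto simp: f_def)
    then show ?thesis using counts_not_encode[OF that False] by simp
  qed
  then have "f \<in> sharpL" by (rule sharpL_if_counts)
  moreover have "is_zero_extension G f"
    unfolding is_zero_extension_def by (auto simp: f g) (auto simp: f_def)
  ultimately show ?thesis by blast
qed

theorem corollary3p20:
  "(\<exists>f \<in> sharpL. is_zero_extension
      (\<lambda>n a b. int (n choose a) * int (n choose b)
             - int (n choose (a - 1)) * int (n choose (b + 1))) f) \<and>
   (\<exists>f \<in> sharpL. is_zero_extension
      (\<lambda>n a b. int ((n + a) choose n) * int ((n + b) choose n)
             - int ((n + a - 1) choose n) * int ((n + b + 1) choose n)) f)"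
proof
  show "\<exists>f \<in> sharpL. is_zero_extension
      (\<lambda>n a b. int (n choose a) * int (n choose b)
             - int (n choose (a - 1)) * int (n choose (b + 1))) f"
    by (rule sharpL_zero_extension[where b = Pairs and g = dominating_pairs])
      (simp_all add: counts_Pairs dominating_pairs_eq)
  show "\<exists>f \<in> sharpL. is_zero_extension
      (\<lambda>n a b. int ((n + a) choose n) * int ((n + b) choose n)
             - int ((n + a - 1) choose n) * int ((n + b + 1) choose n)) f"
    by (rule sharpL_zero_extension[where b = Tab and g = tableaux])
      (simp_all add: counts_Tab tableaux_eq(1))
qed

end
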